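(* Let $A$ be a definite $n\times n$ max-plus matrix with at least one off-diagonal entry different from $-\infty$. Let $\mu\in\mathbb{R}$ be such that $\lambda(\tilde A)\le\mu<0$ if $\lambda(\tilde A)>-\infty$, or such that $-\infty<\mu<0$ if $\lambda(\tilde A)=-\infty$. Then for $y\in\mathrm{eig}(A)$, the distance $d_H(y,\Gamma(\mathrm{eig}(A)))$ is equal to $-\mu$ if and only if $y\in\Gamma(\mathrm{eig}(A_\mu))$.
   Context: All arithmetic is written conventionally on $\mathbb{R}_{\max}=\mathbb{R}\cup\{-\infty\}$, the semiring with addition $\max$ and multiplication $+$; a max-plus matrix is a matrix with entries in $\mathbb{R}_{\max}$, and $(A\odot x)_i=\max_k(A_{ik}+x_k)$. Maximal cycle mean: $\lambda(A)=\max_{\tau}\frac{1}{|K(\tau)|}\sum_{i\in K(\tau)}A_{i\tau(i)}$, where $\tau$ ranges over all cyclic permutations of nonempty subsets $K(\tau)\subseteq\{1,\dots,n\}$ (singletons included). $A$ is definite if $\lambda(A)=0$ and $A_{ii}=0$ for all $i$. $\tilde A$ is the matrix obtained from $A$ by replacing the diagonal entries by $-\infty$. For $\mu\in\mathbb{R}$, $A_\mu$ is the matrix with $(A_\mu)_{ii}=0$ and $(A_\mu)_{ij}=A_{ij}-\mu$ for $i\ne j$; for $\mu\ge\lambda(\tilde A)$ it is definite. Throughout, only eigenvectors with full support (all components real) are considered: for definite $B$, $\mathrm{eig}(B)=\{x\in\mathbb{R}^n : B\odot x=x\}$. The boundary $\Gamma(\mathrm{eig}(B))$ is the union, over all $i\ne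 j$ with $B_{ij}\ne-\infty$, of the faces $\{x\in\mathrm{eig}(B) : x_i-x_j=B_{ij}\}$. This is applied to $B=A$ and $B=A_\mu$. Hilbert distance of $x,y\in\mathbb{R}^n$: $d_H(x,y)=\max_{i,j}(x_i-x_j-y_i+y_j)$. The distance from $y$ to a set $Z$ is $d_H(y,Z)=\inf_{z\in Z}d_H(y,z)$. *)

theory Defs
  imports "HOL-Analysis.Analysis" "HOL-Combinatorics.Orbits"
begin

text \<open>
  The semiring \<open>\<real> \<union> {-\<infinity>}\<close> is represented inside \<^typ>\<open>ereal\<close> by the elements different from
  \<open>\<infinity>\<close>. Away from \<open>\<infinity>\<close>, addition on \<^typ>\<open>ereal\<close> is the max-plus multiplication, with \<open>-\<infinity>\<close> absorbing.
\<close>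

definition maxplus_matrix :: "ereal ^ 'n::finite ^ 'n \<Rightarrow> bool" where
  "maxplus_matrix A \<longleftrightarrow> (\<forall>i j. A $ i $ j \<noteq> \<infinity>)"

definition maxplus_mult_vec :: "ereal ^ 'n::finite ^ 'n \<Rightarrow> ereal ^ 'n \<Rightarrow> ereal ^ 'n"
    (infixl "\<odot>" 70) where
  "A \<odot> x = (\<chi> i. MAX k. A $ i $ k + x $ k)"

text \<open>
  The maximum ranges over pairs of a permutation and its support set \<open>K\<close>, since the set \<open>K\<close>
  cannot be recovered from the permutation when \<open>K\<close> is a singleton. The predicate
  \<^const>\<open>cyclic_on\<close> says that \<open>K\<close> is a single orbit, in particular nonempty.
\<close>

definition max_cycle_mean :: "ereal ^ 'n::finite ^ 'n \<Rightarrow> ereal" where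
  "max_cycle_mean A =
     Max {(\<Sum>i\<in>K. A $ i $ \<tau> i) / ereal (real (card K)) | \<tau> K. \<tau> permutes K \<and> cyclic_on \<tau> K}"

definition definite :: "ereal ^ 'n::finite ^ 'n \<Rightarrow> bool" where
  "definite A \<longleftrightarrow> max_cycle_mean A = 0 \<and> (\<forall>i. A $ i $ i = 0)"

definition off_diagonal :: "ereal ^ 'n::finite ^ 'n \<Rightarrow> ereal ^ 'n ^ 'n" where
  "off_diagonal A = (\<chi> i j. if i = j then -\<infinity> else A $ i $ j)"

definition shifted :: "ereal ^ 'n::finite ^ 'n \<Rightarrow> real \<Rightarrow> ereal ^ 'n ^ 'n" where
  "shifted A \<mu> = (\<chi> i j. if i = j then 0 else A $ i $ j - ereal \<mu>)"

definition eig :: "ereal ^ 'n::finite ^ 'n \<Rightarrow> (real ^ 'n) set" where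
  "eig B = {x. B \<odot> (\<chi> k. ereal (x $ k)) = (\<chi> i. ereal (x $ i))}"

text \<open>
  The boundary is a function of the matrix, not of the set \<^term>\<open>eig B\<close>: the faces depend on
  which entries of \<open>B\<close> are finite.
\<close>

definition eig_boundary :: "ereal ^ 'n::finite ^ 'n \<Rightarrow> (real ^ 'n) set" where
  "eig_boundary B =
     (\<Union>(i, j) \<in> {(i, j). i \<noteq> j \<and> B $ i $ j \<noteq> -\<infinity>}. {x \<in> eig B. ereal (x $ i - x $ j) = B $ i $ j})"

definition hilbert_dist :: "real ^ 'n::finite \<Rightarrow> real ^ 'n \<Rightarrow> real" where
  "hilbert_dist x y = (MAX (i, j). x $ i - x $ j - y $ i + y $ j)"

text \<open>The infimum is taken in \<^typ>\<open>ereal\<close>, so that the distance to the empty set is \<open>\<infinity>\<close>.\<close>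

definition hilbert_setdist :: "real ^ 'n::finite \<Rightarrow> (real ^ 'n) set \<Rightarrow> ereal" where
  "hilbert_setdist y Z = (INF z\<in>Z. ereal (hilbert_dist y z))"

end

(*
  For y in eig A, the slack of an edge (i, j) of A is y_i - y_j - A_ij >= 0. The distance from y to
  the boundary of eig A is the minimal slack r. Indeed, the Hilbert distance from y to the
  face of an edge is at least the slack of that edge, and lowering the i-th coordinate of y by r,
  where (i, j) attains the minimum, stays in eig A, reaches the face of (i, j), and moves y by a
  Hilbert distance of r only. On the other hand, y lies on the boundary of eig (shifted A \<mu>)
  iff the minimal slack is -\<mu>.
*)

theory Submission imports Defs
begin

text \<open>The zero diagonal makes the term \<open>k = i\<close> of the maximum equal to
  \<open>x $ i\<close>, so the maximum is \<open>x $ i\<close> as soon as no term exceeds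
  it.\<close>

lemma mem_eig_iff:
  fixes B :: "ereal ^ 'n::finite ^ 'n"
  assumes "\<And>i. B $ i $ i = 0"
  shows "x \<in> eig B \<longleftrightarrow> (\<forall>i j. B $ i $ j \<le> ereal (x $ i - x $ j))"
proof -
  have "(MAX k. B $ i $ k + ereal (x $ k)) = ereal (x $ i) \<longleftrightarrow>
      (\<forall>k. B $ i $ k + ereal (x $ k) \<le> ereal (x $ i))" for i
  proof -
    have "ereal (x $ i) = B $ i $ i + ereal (x $ i)"
      using assms by simp
    then have "ereal (x $ i) \<in> range (\<lambda>k. B $ i $ k + ereal (x $ k))"
      by (rule range_eqI)
    then show ?thesis
      by (subst Max_eq_iff) (simp_all add: image_iff)
  qed
  moreover have "B $ i $ k + ereal (x $ k) \<le> ereal (x $ i) \<longleftrightarrow> B $ i $ k \<le> ereal (x $ i - x $ k)"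
    for i k
    by (cases "B $ i $ k") auto
  ultimately show ?thesis
    by (simp add: eig_def maxplus_mult_vec_def vec_eq_iff)
qed

text \<open>Moving \<open>\<mu>\<close> to the other side turns both conditions into statements
  about \<open>A\<close>. An entry equal to a real number is finite, so the condition that it
  differs from \<open>-\<infinity>\<close> is absorbed.\<close>

lemma mem_eig_boundary_shifted_iff:
  "x \<in> eig_boundary (shifted A \<mu>) \<longleftrightarrow>
    (\<forall>i j. i \<noteq> j \<longrightarrow> A $ i $ j \<le> ereal (x $ i - x $ j + \<mu>)) \<and>
    (\<exists>i j. i \<noteq> j \<and> A $ i $ j = ereal (x $ i - x $ j + \<mu>))"
proof -
  have ent: "shifted A \<mu> $ i $ j = (if i = j then 0 else A $ i $ j - ereal \<mu>)" for i j
    by (simp add: shifted_def)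
  have le: "A $ i $ j - ereal \<mu> \<le> ereal (x $ i - x $ j) \<longleftrightarrow> A $ i $ j \<le> ereal (x $ i - x $ j + \<mu>)"
    for i j
    by (cases "A $ i $ j") auto
  have eq: "A $ i $ j - ereal \<mu> \<noteq> - \<infinity> \<and> ereal (x $ i - x $ j) = A $ i $ j - ereal \<mu> \<longleftrightarrow>
      A $ i $ j = ereal (x $ i - x $ j + \<mu>)" for i j
    by (cases "A $ i $ j") auto
  have "x \<in> eig (shifted A \<mu>) \<longleftrightarrow>
      (\<forall>i j. i \<noteq> j \<longrightarrow> A $ i $ j \<le> ereal (x $ i - x $ j + \<mu>))"
    by (subst mem_eig_iff) (auto simp: ent le)
  moreover have "x \<in> eig_boundary (shifted A \<mu>) \<longleftrightarrow> x \<in> eig (shifted A \<mu>) \<and>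
      (\<exists>i j. i \<noteq> j \<and> A $ i $ j - ereal \<mu> \<noteq> - \<infinity> \<and> ereal (x $ i - x $ j) = A $ i $ j - ereal \<mu>)"
    unfolding eig_boundary_def by (auto simp: ent)
  ultimately show ?thesis
    by (simp add: eq)
qed

lemma shifted_zero:
  assumes "\<And>i. A $ i $ i = 0"
  shows "shifted A 0 = A"
  using assms by (simp add: shifted_def vec_eq_iff)

lemma le_hilbert_dist: "x $ i - x $ j - y $ i + y $ j \<le> hilbert_dist x y"
  unfolding hilbert_dist_def by (rule Max_ge) (auto intro!: image_eqI[of _ _ "(i, j)"])

lemma hilbert_dist_le:
  assumes "\<And>i j. x $ i - x $ j - y $ i + y $ j \<le> d"
  shows "hilbert_dist x y \<le> d"
  unfolding hilbert_dist_def using assms by (subst Max_le_iff) auto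

lemma hilbert_setdist_eig_boundary:
  fixes A :: "ereal ^ 'n::finite ^ 'n"
  assumes diag: "\<And>i. A $ i $ i = 0" and "\<mu> \<le> 0" and y: "y \<in> eig_boundary (shifted A \<mu>)"
  shows "hilbert_setdist y (eig_boundary A) = ereal (- \<mu>)"
proof (rule antisym)
  have bd: "z \<in> eig_boundary A \<longleftrightarrow>
      (\<forall>i j. i \<noteq> j \<longrightarrow> A $ i $ j \<le> ereal (z $ i - z $ j)) \<and>
      (\<exists>i j. i \<noteq> j \<and> A $ i $ j = ereal (z $ i - z $ j))" for z
    \<comment> \<open>The boundary of \<open>eig A\<close> is the instance
      \<open>\<mu> = 0\<close>.\<close>
    using mem_eig_boundary_shifted_iff[of z A 0] shifted_zero[of A] diag by simp
  have slack: "A $ k $ l \<le> ereal (y $ k - y $ l + \<mu>)" if "k \<noteq> l" for k l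
    using y that by (auto simp: mem_eig_boundary_shifted_iff)
  obtain i j where ij: "i \<noteq> j" "A $ i $ j = ereal (y $ i - y $ j + \<mu>)"
    using y by (auto simp: mem_eig_boundary_shifted_iff)
  define z where "z = y + axis i \<mu>"
  have z_nth: "z $ k = (if k = i then y $ k + \<mu> else y $ k)" for k
    by (simp add: z_def axis_def)
  have "A $ k $ l \<le> ereal (z $ k - z $ l)" if "k \<noteq> l" for k l
    \<comment> \<open>Passing from \<open>y\<close> to \<open>z\<close> lowers a difference of
      coordinates by at most \<open>- \<mu>\<close>, which every edge has as slack.\<close>
    using slack[OF that] by (rule order_trans) (use \<open>\<mu> \<le> 0\<close> that in \<open>auto simp: z_nth\<close>)
  moreover have "A $ i $ j = ereal (z $ i - z $ j)"
    using ij by (simp add: z_nth)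
  ultimately have "z \<in> eig_boundary A"
    using ij bd by blast
  \<comment> \<open>The only coordinate in which \<open>y - z\<close> can be nonzero is the
    \<open>i\<close>-th, with value \<open>- \<mu>\<close>.\<close>
  moreover have "hilbert_dist y z \<le> - \<mu>"
    by (rule hilbert_dist_le) (use \<open>\<mu> \<le> 0\<close> in \<open>auto simp: z_nth\<close>)
  ultimately show "hilbert_setdist y (eig_boundary A) \<le> ereal (- \<mu>)"
    unfolding hilbert_setdist_def by (intro INF_lower2[of z]) auto
  show "ereal (- \<mu>) \<le> hilbert_setdist y (eig_boundary A)"
    unfolding hilbert_setdist_def
  proof (rule INF_greatest)
    fix w assume "w \<in> eig_boundary A"
    then obtain k l where kl: "k \<noteq> l" "A $ k $ l = ereal (w $ k - w $ l)"
      using bd by blast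
    \<comment> \<open>On the face of \<open>(k, l)\<close> the entry is the difference for
      \<open>w\<close>; the slack at \<open>y\<close> then bounds the term of the Hilbert distance
      indexed by \<open>(k, l)\<close>.\<close>
    then have "w $ k - w $ l \<le> y $ k - y $ l + \<mu>"
      using slack[of k l] by simp
    then show "ereal (- \<mu>) \<le> ereal (hilbert_dist y w)"
      using le_hilbert_dist[of y k l w] by simp
  qed
qed

text \<open>The witness is minus the minimal slack; the finite off-diagonal entry ensures that the
  minimum is over a nonempty set.\<close>

lemma ex_mem_eig_boundary_shifted:
  fixes A :: "ereal ^ 'n::finite ^ 'n"
  assumes diag: "\<And>i. A $ i $ i = 0" and "i \<noteq> j" "A $ i $ j \<noteq> - \<infinity>" and "y \<in> eig A"
  shows "\<exists>\<mu>\<le>0. y \<in> eig_boundary (shifted A \<mu>)"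
proof -
  have le: "A $ k $ l \<le> ereal (y $ k - y $ l)" for k l
    using \<open>y \<in> eig A\<close> mem_eig_iff[of A y] diag by blast
  define E where "E = {(k, l). k \<noteq> l \<and> A $ k $ l \<noteq> - \<infinity>}"
  \<comment> \<open>This is the negated slack, so its maximum over \<open>E\<close> is minus the
    minimal slack. On \<open>E\<close> the entries are finite, so the value 0 of
    \<open>real_of_ereal\<close> at infinities does not interfere.\<close>
  define f where "f = (\<lambda>(k, l). real_of_ereal (A $ k $ l) - (y $ k - y $ l))"
  have ent: "A $ k $ l = ereal (y $ k - y $ l + f (k, l))" if "(k, l) \<in> E" for k l
    using that le[of k l] by (cases "A $ k $ l") (auto simp: E_def f_def)
  have "finite (f ` E)" "f ` E \<noteq> {}"
    using assms by (auto simp: E_def)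
  define \<mu> where "\<mu> = Max (f ` E)"
  have "\<mu> \<in> f ` E"
    unfolding \<mu>_def using \<open>finite (f ` E)\<close> \<open>f ` E \<noteq> {}\<close> by (rule Max_in)
  then obtain k l where kl: "(k, l) \<in> E" "\<mu> = f (k, l)"
    by auto
  then have "\<mu> \<le> 0"
    using ent[of k l] le[of k l] by simp
  moreover have "A $ p $ q \<le> ereal (y $ p - y $ q + \<mu>)" if "p \<noteq> q" for p q
  proof (cases "(p, q) \<in> E")
    case True
    then have "f (p, q) \<le> \<mu>"
      unfolding \<mu>_def using \<open>finite (f ` E)\<close> by simp
    then show ?thesis
      using ent[OF True] by simp
  qed (use that in \<open>simp add: E_def\<close>)
  moreover have "k \<noteq> l"
    using kl by (simp add: E_def)
  moreover have "A $ k $ l = ereal (y $ k - y $ l + \<mu>)"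
    using kl ent[of k l] by simp
  ultimately show ?thesis
    unfolding mem_eig_boundary_shifted_iff by blast
qed

theorem proposition18:
  fixes A :: "ereal ^ 'n::finite ^ 'n" and \<mu> :: real and y :: "real ^ 'n"
  assumes "maxplus_matrix A"
    and "definite A"
    and "\<exists>i j. i \<noteq> j \<and> A $ i $ j \<noteq> -\<infinity>"
    and "(max_cycle_mean (off_diagonal A) > -\<infinity> \<and>
            max_cycle_mean (off_diagonal A) \<le> ereal \<mu> \<and> \<mu> < 0) \<or>
         (max_cycle_mean (off_diagonal A) = -\<infinity> \<and> \<mu> < 0)"
    and "y \<in> eig A"
  shows "hilbert_setdist y (eig_boundary A) = ereal (- \<mu>) \<longleftrightarrow> y \<in> eig_boundary (shifted A \<mu>)"
proof
  have diag: "A $ i $ i = 0" for i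
    using assms(2) by (simp add: definite_def)
  \<comment> \<open>The distance is \<open>- \<nu>\<close> by the direction already proved, so it
    determines \<open>\<nu>\<close>.\<close>
  obtain \<nu> where \<nu>: "\<nu> \<le> 0" "y \<in> eig_boundary (shifted A \<nu>)"
    using ex_mem_eig_boundary_shifted[OF diag] assms(3,5) by blast
  assume "hilbert_setdist y (eig_boundary A) = ereal (- \<mu>)"
  then have "\<nu> = \<mu>"
    using hilbert_setdist_eig_boundary[OF diag \<nu>] by simp
  then show "y \<in> eig_boundary (shifted A \<mu>)"
    using \<nu> by simp
next
  assume "y \<in> eig_boundary (shifted A \<mu>)"
  moreover have "A $ i $ i = 0" for i
    using assms(2) by (simp add: definite_def)
  moreover have "\<mu> \<le> 0"
    using assms(4) by auto
  ultimately show "hilbert_setdist y (eig_boundary A) = ereal (- \<mu>)"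
    by (intro hilbert_setdist_eig_boundary)
qed

end
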